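(* Let $G$ be a graph with $n\ge7$ vertices. Then $M[IAS(G)]$ has a transverse circuit of size $\le\frac{n}{2}$.
   Context: A graph is a finite looped simple graph; $A(G)$ is its $GF(2)$ adjacency matrix (diagonal 1 iff looped). $M[IAS(G)]$ is the binary matroid represented by $(I\;A(G)\;A(G)+I)$, with elements $\phi_G(v),\chi_G(v),\psi_G(v)$ (the $v$ columns of $I,A(G),A(G)+I$) and vertex triples $\tau_G(v)=\{\phi_G(v),\chi_G(v),\psi_G(v)\}$. A transversal is a subset of the ground set meeting every vertex triple exactly once; a transverse circuit is a circuit of $M[IAS(G)]$ contained in some transversal. *)

theory Defs
  imports Complex_Main "HOL-Library.Z2"
begin

text \<open>
  An edge is the set of its end-vertices; a loop at \<open>v\<close> is the singleton \<open>{v, v} = {v}\<close>.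
\<close>

definition looped_simple_graph :: "'v set \<Rightarrow> 'v set set \<Rightarrow> bool" where
  "looped_simple_graph V E \<longleftrightarrow> finite V \<and> E \<subseteq> {{u, v} | u v. u \<in> V \<and> v \<in> V}"

definition adj_matrix :: "'v set set \<Rightarrow> 'v \<Rightarrow> 'v \<Rightarrow> bit" where
  "adj_matrix E u v = of_bool ({u, v} \<in> E)"

definition id_matrix :: "'v \<Rightarrow> 'v \<Rightarrow> bit" where
  "id_matrix u v = of_bool (u = v)"

text \<open>
  A matroid is a pair of its ground set and its family of independent sets.
\<close>

type_synonym 'a matroid = "'a set \<times> 'a set set"

text \<open>
  The binary matroid represented by the matrix \<open>M\<close> with row set \<open>R\<close> and column set \<open>W\<close>.
  Its elements are the column labels, so that equal columns give distinct parallel elements;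
  this is why independence is that of a family rather than of a set of vectors.
\<close>

definition represented_matroid :: "'r set \<Rightarrow> 'a set \<Rightarrow> ('r \<Rightarrow> 'a \<Rightarrow> bit) \<Rightarrow> 'a matroid" where
  "represented_matroid R W M =
    (W, {S. S \<subseteq> W \<and>
            (\<forall>c :: 'a \<Rightarrow> bit. (\<forall>r\<in>R. (\<Sum>x\<in>S. c x * M r x) = 0) \<longrightarrow> (\<forall>x\<in>S. c x = 0))})"

definition circuit :: "'a matroid \<Rightarrow> 'a set \<Rightarrow> bool" where
  "circuit N C \<longleftrightarrow> C \<subseteq> fst N \<and> C \<notin> snd N \<and> (\<forall>D. D \<subset> C \<longrightarrow> D \<in> snd N)"

datatype 'v ias_elem = Phi 'v | Chi 'v | Psi 'v

definition vertex_triple :: "'v \<Rightarrow> 'v ias_elem set" where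
  "vertex_triple v = {Phi v, Chi v, Psi v}"

definition ias_ground :: "'v set \<Rightarrow> 'v ias_elem set" where
  "ias_ground V = (\<Union>v\<in>V. vertex_triple v)"

fun ias_matrix :: "'v set set \<Rightarrow> 'v \<Rightarrow> 'v ias_elem \<Rightarrow> bit" where
  "ias_matrix E u (Phi v) = id_matrix u v"
| "ias_matrix E u (Chi v) = adj_matrix E u v"
| "ias_matrix E u (Psi v) = adj_matrix E u v + id_matrix u v"

definition ias_matroid :: "'v set \<Rightarrow> 'v set set \<Rightarrow> 'v ias_elem matroid" where
  "ias_matroid V E = represented_matroid V (ias_ground V) (ias_matrix E)"

definition transversal :: "'v set \<Rightarrow> 'v ias_elem set \<Rightarrow> bool" where
  "transversal V T \<longleftrightarrow> T \<subseteq> ias_ground V \<and> (\<forall>v\<in>V. card (T \<inter> vertex_triple v) = 1)"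

definition transverse_circuit :: "'v set \<Rightarrow> 'v set set \<Rightarrow> 'v ias_elem set \<Rightarrow> bool" where
  "transverse_circuit V E C \<longleftrightarrow>
     circuit (ias_matroid V E) C \<and> (\<exists>T. transversal V T \<and> C \<subseteq> T)"

end

theory Submission
  imports Defs
begin

text \<open>
  A choice of at most one element of each vertex triple whose columns sum to zero is given by the
  set \<open>X\<close> of vertices where a column of \<open>A(G)\<close> or \<open>A(G) + I\<close> is used; \<open>Phi\<close> or \<open>Psi\<close> is then
  used exactly at the vertices with an odd number of neighbours in \<open>X\<close>. These choices are the words
  of an additive self-dual code over \<open>GF(4)\<close> of length \<open>n\<close> with \<open>2 ^ n\<close> words, and we need a
  nonzero word of weight at most \<open>n / 2\<close>.

  Suppose there is none. By duality, a set of \<open>t > n / 2\<close> coordinates supports exactly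
  \<open>2 ^ (2 * t - n)\<close> words, and this determines the number \<open>N t\<close> of words whose support is a given
  set of size \<open>t\<close>. If \<open>n = 2 * m\<close> then \<open>N (m + 2) = 9 - 3 * m\<close>, which is negative for \<open>m \<ge> 4\<close>;
  if \<open>n = 2 * m + 1\<close> then \<open>N (m + 2) = 5 - m\<close>, which is negative for \<open>m \<ge> 6\<close>. For \<open>n = 7, 9, 11\<close>
  we use that the parity of the weight is additive on a self-dual code, so that the words within
  a given set are either all of even weight or half of them are. This fails for sets of sizes
  6, 7 and 9, respectively.
\<close>

section \<open>Signs and supports of words\<close>

definition edge_sign :: "'v set set \<Rightarrow> 'v \<Rightarrow> 'v \<Rightarrow> int" where
  "edge_sign E x y = (if {x, y} \<in> E then - 1 else 1)"

text \<open>
  The character \<open>(-1) ^ (x\<^sup>T A y)\<close> for the indicator vectors \<open>x\<close>, \<open>y\<close> of \<open>X\<close>, \<open>Y\<close>.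
\<close>

definition pairing :: "'v set set \<Rightarrow> 'v set \<Rightarrow> 'v set \<Rightarrow> int" where
  "pairing E X Y = (\<Prod>x\<in>X. \<Prod>y\<in>Y. edge_sign E x y)"

text \<open>A looped vertex of \<open>X\<close> counts as its own neighbour.\<close>

definition odd_nbrs :: "'v set \<Rightarrow> 'v set set \<Rightarrow> 'v set \<Rightarrow> 'v set" where
  "odd_nbrs V E X = {v \<in> V. pairing E X {v} = - 1}"

definition word_support :: "'v set \<Rightarrow> 'v set set \<Rightarrow> 'v set \<Rightarrow> 'v set" where
  "word_support V E X = X \<union> odd_nbrs V E X"

text \<open>A word is identified with its \<open>X\<close>, so this is the subcode vanishing outside
  \<open>T\<close>.\<close>

definition words_within :: "'v set \<Rightarrow> 'v set set \<Rightarrow> 'v set \<Rightarrow> 'v set set" where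
  "words_within V E T = {X \<in> Pow V. word_support V E X \<subseteq> T}"

lemma prod_eq_1_or_minus_1:
  fixes f :: "'a \<Rightarrow> int"
  assumes "\<And>x. x \<in> A \<Longrightarrow> f x = 1 \<or> f x = - 1"
  shows "prod f A = 1 \<or> prod f A = - 1"
  using assms
proof (induction A rule: infinite_finite_induct)
  case (insert x F)
  then have "f x = 1 \<or> f x = - 1" and "prod f F = 1 \<or> prod f F = - 1"
    by simp_all
  with insert.hyps show ?case
    by fastforce
qed auto

text \<open>Factors over \<open>X \<inter> Y\<close> occur twice and square to 1. Signs thus turn
  addition of GF(2) vectors into multiplication.\<close>

lemma prod_sym_diff:
  fixes f :: "'a \<Rightarrow> int"
  assumes "finite X" "finite Y" and sq: "\<And>x. f x * f x = 1"
  shows "prod f (sym_diff X Y) = prod f X * prod f Y"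
proof -
  have "prod f X = prod f (X - Y) * prod f (X \<inter> Y)"
    using prod.Int_Diff[OF assms(1), of f Y] by (simp add: mult.commute)
  moreover have "prod f Y = prod f (Y - X) * prod f (X \<inter> Y)"
    using prod.Int_Diff[OF assms(2), of f X] by (simp add: mult.commute Int_commute)
  moreover have "prod f (sym_diff X Y) = prod f (X - Y) * prod f (Y - X)"
    using assms by (intro prod.union_disjoint) auto
  moreover have "prod f (X \<inter> Y) * prod f (X \<inter> Y) = 1"
    by (simp add: prod.distrib[symmetric] sq)
  ultimately show ?thesis
    by (metis (no_types, lifting) mult.assoc mult.commute mult_1)
qed

lemma pairing_eq_1_or_minus_1: "pairing E X Y = 1 \<or> pairing E X Y = - 1"
  unfolding pairing_def by (intro prod_eq_1_or_minus_1) (auto simp: edge_sign_def)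

lemma pairing_square: "pairing E X Y * pairing E X Y = 1"
  using pairing_eq_1_or_minus_1[of E X Y] by auto

lemma pairing_commute: "pairing E X Y = pairing E Y X"
proof -
  have "pairing E X Y = (\<Prod>y\<in>Y. \<Prod>x\<in>X. edge_sign E x y)"
    unfolding pairing_def by (rule prod.swap)
  then show ?thesis
    by (simp add: pairing_def edge_sign_def insert_commute)
qed

lemma pairing_eq_prod_singleton: "pairing E X Y = (\<Prod>y\<in>Y. pairing E X {y})"
  unfolding pairing_def by (subst prod.swap) simp

lemma pairing_sym_diff_right:
  assumes "finite Y" "finite Z"
  shows "pairing E X (sym_diff Y Z) = pairing E X Y * pairing E X Z"
  using prod_sym_diff[OF assms, of "\<lambda>v. pairing E X {v}"]
  by (simp add: pairing_square flip: pairing_eq_prod_singleton)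

lemma pairing_sym_diff_left:
  assumes "finite X" "finite Y"
  shows "pairing E (sym_diff X Y) Z = pairing E X Z * pairing E Y Z"
  using pairing_sym_diff_right[OF assms] by (simp add: pairing_commute[of E _ Z])

lemma pairing_empty: "pairing E {} Y = 1"
  by (simp add: pairing_def)

lemma odd_nbrs_empty: "odd_nbrs V E {} = {}"
  by (simp add: odd_nbrs_def pairing_empty)

lemma word_support_empty: "word_support V E {} = {}"
  by (simp add: word_support_def odd_nbrs_empty)

lemma odd_nbrs_sym_diff:
  assumes "finite X" "finite Y"
  shows "odd_nbrs V E (sym_diff X Y) = sym_diff (odd_nbrs V E X) (odd_nbrs V E Y)"
proof -
  have "pairing E (sym_diff X Y) {v} = - 1 \<longleftrightarrow> (pairing E X {v} = - 1) \<noteq> (pairing E Y {v} = - 1)" for v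
    using pairing_eq_1_or_minus_1[of E X "{v}"] pairing_eq_1_or_minus_1[of E Y "{v}"]
    by (auto simp: pairing_sym_diff_left[OF assms])
  then show ?thesis
    unfolding odd_nbrs_def by blast
qed

lemma word_support_sym_diff_subset:
  assumes "finite X" "finite Y"
  shows "word_support V E (sym_diff X Y) \<subseteq> word_support V E X \<union> word_support V E Y"
  unfolding word_support_def odd_nbrs_sym_diff[OF assms] by blast

section \<open>Parity of the weight\<close>

lemma minus_one_power_card_sym_diff:
  assumes "finite X" "finite Y"
  shows "(- 1 :: int) ^ card (sym_diff X Y) = (- 1) ^ card X * (- 1) ^ card Y"
  using prod_sym_diff[OF assms, of "\<lambda>_. - 1"] by simp

text \<open>Inclusion-exclusion for \<open>X\<close> and \<open>odd_nbrs V E X\<close>: taken vertex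
  by vertex, \<open>pairing E X X\<close> has a factor -1 exactly on their intersection.\<close>

lemma word_sign:
  assumes "finite V" "X \<subseteq> V"
  shows "(- 1 :: int) ^ card (word_support V E X)
    = (- 1) ^ card X * (- 1) ^ card (odd_nbrs V E X) * pairing E X X"
proof -
  have fin: "finite X" "finite (odd_nbrs V E X)"
    using assms finite_subset by (auto simp: odd_nbrs_def)
  have "pairing E X X = (\<Prod>x\<in>X. if x \<in> odd_nbrs V E X then - 1 else 1)"
    unfolding pairing_eq_prod_singleton[of E X X]
    using assms pairing_eq_1_or_minus_1[of E X]
    by (intro prod.cong) (auto simp: odd_nbrs_def)
  also have "\<dots> = (- 1) ^ card (X \<inter> odd_nbrs V E X)"
    using fin by (simp add: prod.If_cases Int_def)
  finally have p: "pairing E X X = (- 1) ^ card (X \<inter> odd_nbrs V E X)" .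
  have "card X + card (odd_nbrs V E X)
      = card (word_support V E X) + card (X \<inter> odd_nbrs V E X)"
    unfolding word_support_def by (rule card_Un_Int) (use fin in auto)
  then have "(- 1 :: int) ^ card X * (- 1) ^ card (odd_nbrs V E X)
      = (- 1) ^ card (word_support V E X) * pairing E X X"
    unfolding p by (simp flip: power_add)
  then show ?thesis
    using pairing_square[of E X X] by (simp add: mult.assoc)
qed

text \<open>The two cross terms of the pairing agree, since the adjacency matrix is symmetric, and
  so cancel.\<close>

lemma word_sign_sym_diff:
  assumes "finite V" "X \<subseteq> V" "Y \<subseteq> V"
  shows "(- 1 :: int) ^ card (word_support V E (sym_diff X Y))
    = (- 1) ^ card (word_support V E X) * (- 1) ^ card (word_support V E Y)"
proof -
  have fin: "finite X" "finite Y" and finN: "finite (odd_nbrs V E X)" "finite (odd_nbrs V E Y)"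
    using assms finite_subset by (auto simp: odd_nbrs_def)
  have "pairing E (sym_diff X Y) (sym_diff X Y)
      = pairing E X X * pairing E Y Y * (pairing E X Y * pairing E X Y)"
    by (simp add: pairing_sym_diff_left[OF fin] pairing_sym_diff_right[OF fin]
        pairing_commute[of E Y X] mult_ac)
  moreover have "sym_diff X Y \<subseteq> V"
    using assms by blast
  ultimately show ?thesis
    using assms
    by (simp add: word_sign odd_nbrs_sym_diff[OF fin] pairing_square
        minus_one_power_card_sym_diff[OF fin] minus_one_power_card_sym_diff[OF finN] mult_ac
        del: Diff_subset)
qed

section \<open>Character sums and duality\<close>

text \<open>The sum factors over \<open>T\<close> into terms \<open>pairing E Y {v} + 1\<close>,
  each 2 or 0.\<close>

lemma sum_Pow_pairing:
  assumes "finite T"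
  shows "(\<Sum>X\<in>Pow T. pairing E Y X) = (if \<forall>v\<in>T. pairing E Y {v} = 1 then 2 ^ card T else 0)"
proof -
  have "(\<Sum>X\<in>Pow T. pairing E Y X) = (\<Prod>v\<in>T. pairing E Y {v} + 1)"
    using prod_add[OF assms, of "\<lambda>v. pairing E Y {v}" "\<lambda>_. 1"]
    by (simp flip: pairing_eq_prod_singleton)
  also have "\<dots> = (if \<forall>v\<in>T. pairing E Y {v} = 1 then 2 ^ card T else 0)"
  proof (cases "\<forall>v\<in>T. pairing E Y {v} = 1")
    case True
    then show ?thesis by simp
  next
    case False
    then obtain v where "v \<in> T" "pairing E Y {v} = - 1"
      using pairing_eq_1_or_minus_1 by metis
    then have "(\<Prod>v\<in>T. pairing E Y {v} + 1) = 0"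
      using assms by (intro prod_zero bexI[of _ v]) simp_all
    then show ?thesis
      using False by simp
  qed
  finally show ?thesis .
qed

text \<open>This form is the condition for a nonzero character sum over the subsets of
  \<open>V - T\<close>.\<close>

lemma words_within_eq:
  assumes "T \<subseteq> V"
  shows "words_within V E T = {X \<in> Pow T. \<forall>v\<in>V - T. pairing E X {v} = 1}"
proof -
  have "pairing E X {v} = 1 \<longleftrightarrow> pairing E X {v} \<noteq> - 1" for X v
    using pairing_eq_1_or_minus_1[of E X "{v}"] by auto
  then show ?thesis
    using assms by (auto simp: words_within_def word_support_def odd_nbrs_def)
qed

text \<open>
  MacWilliams duality for a self-dual code: both sides are the double sum of \<^const>\<open>pairing\<close> over
  the subsets of \<open>T\<close> and of \<open>V - T\<close>.
\<close>

lemma card_words_within_duality: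
  assumes "finite V" "T \<subseteq> V"
  shows "2 ^ card (V - T) * card (words_within V E T)
    = 2 ^ card T * card (words_within V E (V - T))"
proof -
  have sum_eq: "(\<Sum>X\<in>Pow S. \<Sum>Y\<in>Pow (V - S). pairing E X Y)
      = 2 ^ card (V - S) * int (card (words_within V E S))" if "S \<subseteq> V" for S
  proof -
    have "finite S"
      using that assms finite_subset by blast
    then show ?thesis
      using assms that
      by (simp add: sum_Pow_pairing words_within_eq sum.If_cases Int_def)
  qed
  have "2 ^ card (V - T) * int (card (words_within V E T))
      = (\<Sum>Y\<in>Pow (V - T). \<Sum>X\<in>Pow T. pairing E Y X)"
    unfolding sum_eq[OF assms(2), symmetric]
    by (subst sum.swap) (simp add: pairing_commute)
  also have "\<dots> = 2 ^ card T * int (card (words_within V E (V - T)))"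
    using sum_eq[of "V - T"] assms by (simp add: double_diff)
  finally show ?thesis
    by (simp flip: of_nat_eq_iff[where ?'a = int])
qed

lemma sum_word_sign:
  assumes "finite V" "T \<subseteq> V"
  shows "(\<Sum>X\<in>words_within V E T. (- 1 :: int) ^ card (word_support V E X))
    \<in> {0, int (card (words_within V E T))}"
proof (cases "\<exists>Z\<in>words_within V E T. (- 1 :: int) ^ card (word_support V E Z) \<noteq> 1")
  case False
  then show ?thesis by simp
next
  case True
  let ?W = "words_within V E T" and ?s = "\<lambda>X. (- 1 :: int) ^ card (word_support V E X)"
  from True obtain Z where Z: "Z \<in> ?W" "?s Z = - 1"
    by (metis minus_one_power_iff)
  have sub: "X \<subseteq> V \<and> finite X" if "X \<in> ?W" for X
    using that assms finite_subset by (auto simp: words_within_def)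
  have closed: "sym_diff X Z \<in> ?W" if "X \<in> ?W" for X
    using word_support_sym_diff_subset[of X Z V E] sub[OF that] sub[OF Z(1)] that Z(1)
    by (auto simp: words_within_def)
  \<comment> \<open>Adding the odd-weight word \<open>Z\<close> permutes the words and flips each
    sign, so the sum equals its negative.\<close>
  have "(\<Sum>X\<in>?W. ?s X) = (\<Sum>X\<in>?W. ?s (sym_diff X Z))"
    by (rule sum.reindex_bij_witness[where i = "\<lambda>X. sym_diff X Z" and j = "\<lambda>X. sym_diff X Z"])
      (auto simp: closed intro!: arg_cong[where f = ?s])
  also have "\<dots> = (\<Sum>X\<in>?W. - ?s X)"
    using sub Z assms by (intro sum.cong) (auto simp: word_sign_sym_diff)
  finally show ?thesis
    by (simp add: sum_negf)
qed


section \<open>Counting words by support\<close>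

lemma sum_Pow_card:
  assumes "finite T"
  shows "(\<Sum>S\<in>Pow T. f (card S)) = (\<Sum>s\<le>card T. of_nat (card T choose s) * (f s :: int))"
proof -
  have "(\<Sum>S\<in>Pow T. f (card S)) = (\<Sum>s\<le>card T. \<Sum>S\<in>{S \<in> Pow T. card S = s}. f (card S))"
    using assms by (intro sum.group[symmetric]) (auto simp: card_mono)
  also have "\<dots> = (\<Sum>s\<le>card T. of_nat (card T choose s) * f s)"
  proof (rule sum.cong[OF refl])
    fix s
    have "(\<Sum>S\<in>{S \<in> Pow T. card S = s}. f (card S)) = (\<Sum>S\<in>{S \<in> Pow T. card S = s}. f s)"
      by (rule sum.cong) auto
    then show "(\<Sum>S\<in>{S \<in> Pow T. card S = s}. f (card S)) = of_nat (card T choose s) * f s"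
      using n_subsets[OF assms, of s] by simp
  qed
  finally show ?thesis .
qed

definition words_with_support :: "'v set \<Rightarrow> 'v set set \<Rightarrow> 'v set \<Rightarrow> 'v set set" where
  "words_with_support V E S = {X \<in> Pow V. word_support V E X = S}"

lemma sum_words_within:
  fixes h :: "'v set \<Rightarrow> int"
  assumes "finite V" "T \<subseteq> V"
  shows "(\<Sum>X\<in>words_within V E T. h (word_support V E X))
    = (\<Sum>S\<in>Pow T. h S * int (card (words_with_support V E S)))"
proof -
  have fin: "finite T"
    using assms finite_subset by blast
  have "(\<Sum>X\<in>words_within V E T. h (word_support V E X))
      = (\<Sum>S\<in>Pow T. \<Sum>X\<in>{X \<in> words_within V E T. word_support V E X = S}. h (word_support V E X))"
    using assms fin by (intro sum.group[symmetric]) (auto simp: words_within_def)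
  also have "\<dots> = (\<Sum>S\<in>Pow T. h S * int (card (words_with_support V E S)))"
  proof (rule sum.cong[OF refl])
    fix S assume "S \<in> Pow T"
    then have "{X \<in> words_within V E T. word_support V E X = S} = words_with_support V E S"
      by (auto simp: words_within_def words_with_support_def)
    then show "(\<Sum>X\<in>{X \<in> words_within V E T. word_support V E X = S}. h (word_support V E X))
        = h S * int (card (words_with_support V E S))"
      by (simp add: words_with_support_def)
  qed
  finally show ?thesis .
qed

text \<open>
  The number \<open>N t\<close> for a code of length \<open>n\<close> without words of weight at most \<open>n / 2\<close>, obtained by
  solving \<open>\<Sum>s\<le>t. (t choose s) * N s = 2 ^ (2 * t - n)\<close>, where the right-hand side is replaced by 1
  if \<open>2 * t \<le> n\<close>.
\<close>

fun extremal_count :: "nat \<Rightarrow> nat \<Rightarrow> int" where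
  "extremal_count n t = (if 2 * t \<le> n then 1 else 2 ^ (2 * t - n))
    - (\<Sum>s<t. int (t choose s) * extremal_count n s)"

declare extremal_count.simps [simp del]

lemma sum_extremal_count:
  "(\<Sum>s\<le>t. int (t choose s) * extremal_count n s) = (if 2 * t \<le> n then 1 else 2 ^ (2 * t - n))"
  by (simp add: extremal_count.simps[of n t] flip: lessThan_Suc_atMost)

lemma extremal_count_0: "extremal_count n 0 = 1"
  by (simp add: extremal_count.simps[of n 0])

text \<open>By induction only the term \<open>s = 0\<close> of the recursion survives, and it
  cancels the 1.\<close>

lemma extremal_count_small:
  assumes "0 < t" "2 * t \<le> n"
  shows "extremal_count n t = 0"
  using assms
proof (induction t rule: less_induct)
  case (less t)
  have "(\<Sum>s<t. int (t choose s) * extremal_count n s) = (\<Sum>s<t. if s = 0 then 1 else 0)"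
    using less by (intro sum.cong) (auto simp: extremal_count_0)
  also have "\<dots> = 1"
    using less.prems by simp
  finally show ?case
    using less.prems by (simp add: extremal_count.simps[of n t])
qed

lemma sum_extremal_count_split:
  assumes "2 * m \<le> n"
  shows "(\<Sum>s\<le>m + k. f s * extremal_count n s)
    = f 0 + (\<Sum>i<k. f (m + 1 + i) * extremal_count n (m + 1 + i))"
proof (induction k)
  case 0
  have "(\<Sum>s\<le>m. f s * extremal_count n s) = (\<Sum>s\<le>m. if s = 0 then f 0 else 0)"
    using assms by (intro sum.cong) (auto simp: extremal_count_0 extremal_count_small)
  then show ?case by simp
next
  case (Suc k)
  then show ?case by simp
qed

section \<open>Codes without light words\<close>

text \<open>A set of at most half the vertices holds only the zero word; a larger one has such a
  complement, and duality gives its count.\<close>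

lemma card_words_within_of_large_supports:
  assumes fin: "finite V"
    and large: "\<And>X. X \<subseteq> V \<Longrightarrow> X \<noteq> {} \<Longrightarrow> card V < 2 * card (word_support V E X)"
    and T: "T \<subseteq> V"
  shows "card (words_within V E T) = (if 2 * card T \<le> card V then 1 else 2 ^ (2 * card T - card V))"
proof -
  have small: "card (words_within V E S) = 1" if S: "S \<subseteq> V" "2 * card S \<le> card V" for S
  proof -
    have "X = {}" if "X \<subseteq> V" "word_support V E X \<subseteq> S" for X
    proof (rule ccontr)
      assume "X \<noteq> {}"
      moreover have "card (word_support V E X) \<le> card S"
        by (rule card_mono[OF finite_subset[OF S(1) fin] that(2)])
      ultimately show False
        using large[OF that(1)] S by simp
    qed
    then have "words_within V E S = {{}}"
      by (auto simp: words_within_def word_support_empty)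
    then show ?thesis by simp
  qed
  show ?thesis
  proof (cases "2 * card T \<le> card V")
    case True
    then show ?thesis using small T by simp
  next
    case False
    have le: "card T \<le> card V"
      using fin T card_mono by blast
    have c: "card (V - T) = card V - card T"
      using fin T by (simp add: card_Diff_subset finite_subset)
    have "2 ^ card (V - T) * card (words_within V E T) = 2 ^ card T"
      using card_words_within_duality[OF fin T, of E] small[of "V - T"] c False by simp
    also have "\<dots> = 2 ^ card (V - T) * 2 ^ (2 * card T - card V)"
      using False le c by (simp flip: power_add)
    finally show ?thesis
      using False by simp
  qed
qed

text \<open>Grouping the words within \<open>S\<close> by support gives the recursion of
  \<open>extremal_count\<close>; by induction on \<open>card S\<close> only the term for
  \<open>S\<close> itself is left.\<close>

lemma card_words_with_support_of_large_supports:
  assumes fin: "finite V"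
    and large: "\<And>X. X \<subseteq> V \<Longrightarrow> X \<noteq> {} \<Longrightarrow> card V < 2 * card (word_support V E X)"
    and "S \<subseteq> V"
  shows "int (card (words_with_support V E S)) = extremal_count (card V) (card S)"
  using \<open>S \<subseteq> V\<close>
proof (induction "card S" arbitrary: S rule: less_induct)
  case less
  have finS: "finite S"
    using fin less.prems finite_subset by blast
  let ?N = "\<lambda>R. int (card (words_with_support V E R))"
  have split: "sum f (Pow S) = f S + sum f (Pow S - {S})" for f :: "'a set \<Rightarrow> int"
    using finS by (intro sum.remove) auto
  have "(\<Sum>R\<in>Pow S - {S}. ?N R) = (\<Sum>R\<in>Pow S - {S}. extremal_count (card V) (card R))"
  proof (rule sum.cong[OF refl])
    fix R assume "R \<in> Pow S - {S}"
    then have "R \<subset> S" by auto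
    then show "?N R = extremal_count (card V) (card R)"
      using less psubset_card_mono[OF finS] by (meson dual_order.trans psubset_imp_subset)
  qed
  moreover have "sum ?N (Pow S) = int (card (words_within V E S))"
    using sum_words_within[OF fin less.prems, of "\<lambda>_. 1" E] by simp
  moreover have "\<dots> = (\<Sum>R\<in>Pow S. extremal_count (card V) (card R))"
    unfolding sum_Pow_card[OF finS] sum_extremal_count
    using card_words_within_of_large_supports[of V E, OF fin large less.prems] by simp
  ultimately show ?case
    using split[of ?N] split[of "\<lambda>R. extremal_count (card V) (card R)"] by simp
qed

text \<open>The values count actual words, hence the first claim; the second is
  \<open>sum_word_sign\<close> for a set of size \<open>t\<close>.\<close>

lemma extremal_count_constraints:
  assumes fin: "finite V"
    and large: "\<And>X. X \<subseteq> V \<Longrightarrow> X \<noteq> {} \<Longrightarrow> card V < 2 * card (word_support V E X)"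
    and t: "t \<le> card V"
  shows "0 \<le> extremal_count (card V) t"
    and "(\<Sum>s\<le>t. (- 1) ^ s * int (t choose s) * extremal_count (card V) s)
      \<in> {0, \<Sum>s\<le>t. int (t choose s) * extremal_count (card V) s}"
proof -
  obtain T where T: "T \<subseteq> V" "card T = t"
    using t by (meson obtain_subset_with_card_n)
  have finT: "finite T"
    using fin T finite_subset by blast
  have count: "int (card (words_with_support V E S)) = extremal_count (card V) (card S)"
    if "S \<subseteq> V" for S
    using card_words_with_support_of_large_supports[OF fin large that] .
  show "0 \<le> extremal_count (card V) t"
    using count[OF T(1)] T(2) by (metis of_nat_0_le_iff)
  have "(\<Sum>X\<in>words_within V E T. (- 1 :: int) ^ card (word_support V E X))
      = (\<Sum>S\<in>Pow T. (- 1) ^ card S * extremal_count (card V) (card S))"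
    unfolding sum_words_within[OF fin T(1), of "\<lambda>S. (- 1) ^ card S"]
    using T(1) by (intro sum.cong) (auto simp: count)
  also have "\<dots> = (\<Sum>s\<le>t. (- 1) ^ s * int (t choose s) * extremal_count (card V) s)"
    using sum_Pow_card[OF finT, of "\<lambda>s. (- 1) ^ s * extremal_count (card V) s"] T(2)
    by (simp add: mult_ac)
  finally have *: "(\<Sum>X\<in>words_within V E T. (- 1 :: int) ^ card (word_support V E X))
      = (\<Sum>s\<le>t. (- 1) ^ s * int (t choose s) * extremal_count (card V) s)" .
  have "int (card (words_within V E T)) = (\<Sum>s\<le>t. int (t choose s) * extremal_count (card V) s)"
    unfolding sum_extremal_count
    using card_words_within_of_large_supports[of V E, OF fin large T(1)] T(2) by simp
  then show "(\<Sum>s\<le>t. (- 1) ^ s * int (t choose s) * extremal_count (card V) s)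
      \<in> {0, \<Sum>s\<le>t. int (t choose s) * extremal_count (card V) s}"
    using sum_word_sign[OF fin T(1), of E] * by simp
qed

section \<open>Numerical contradictions\<close>

text \<open>A triangular system: increasing \<open>k\<close> yields the values at
  \<open>m + 1\<close>, \<open>m + 2\<close>, ... in turn.\<close>

lemma extremal_count_recurrence:
  assumes "2 * m \<le> n" "n < 2 * (m + k)"
  shows "1 + (\<Sum>i<k. int (m + k choose (m + 1 + i)) * extremal_count n (m + 1 + i))
    = 2 ^ (2 * (m + k) - n)"
  using sum_extremal_count[of "m + k" n] assms(2)
    sum_extremal_count_split[OF assms(1), of "\<lambda>s. int (m + k choose s)" k] by simp

text \<open>The value at \<open>m + 1\<close> is 3, which leaves
  \<open>16 - 1 - 3 * (m + 2)\<close>.\<close>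

lemma extremal_count_even: "extremal_count (2 * m) (m + 2) = 9 - 3 * int m"
  using extremal_count_recurrence[of m "2 * m" 1] extremal_count_recurrence[of m "2 * m" 2]
  by (simp add: eval_nat_numeral binomial_eq_0)

text \<open>The value at \<open>m + 1\<close> is 1, which leaves
  \<open>8 - 1 - (m + 2)\<close>.\<close>

lemma extremal_count_odd: "extremal_count (2 * m + 1) (m + 2) = 5 - int m"
  using extremal_count_recurrence[of m "2 * m + 1" 1] extremal_count_recurrence[of m "2 * m + 1" 2]
  by (simp add: eval_nat_numeral binomial_eq_0)

text \<open>The values at 4, 5, 6 are 1, 2, 4, giving \<open>1 + 15 - 12 + 4\<close>; parity allows
  only 0 or 32.\<close>

lemma extremal_parity_sum_7: "(\<Sum>s\<le>6. (- 1) ^ s * int (6 choose s) * extremal_count 7 s) = 8"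
  using extremal_count_recurrence[of 3 7 1] extremal_count_recurrence[of 3 7 2]
    extremal_count_recurrence[of 3 7 3]
    sum_extremal_count_split[of 3 7 "\<lambda>s. (- 1) ^ s * int (6 choose s)" 3]
  by (simp add: lessThan_nat_numeral binomial_fact' fact_numeral)

text \<open>The values at 5, 6, 7 are 1, 1, 3, giving \<open>1 - 21 + 7 - 3\<close>, against 0 or
  32.\<close>

lemma extremal_parity_sum_9: "(\<Sum>s\<le>7. (- 1) ^ s * int (7 choose s) * extremal_count 9 s) = - 16"
  using extremal_count_recurrence[of 4 9 1] extremal_count_recurrence[of 4 9 2]
    extremal_count_recurrence[of 4 9 3]
    sum_extremal_count_split[of 4 9 "\<lambda>s. (- 1) ^ s * int (7 choose s)" 3]
  by (simp add: lessThan_nat_numeral binomial_fact' fact_numeral)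

text \<open>The values at 6 to 9 are 1, 0, 3, 16, giving \<open>1 + 84 - 0 + 27 - 16\<close>,
  against 0 or 128.\<close>

lemma extremal_parity_sum_11: "(\<Sum>s\<le>9. (- 1) ^ s * int (9 choose s) * extremal_count 11 s) = 96"
  using extremal_count_recurrence[of 5 11 1] extremal_count_recurrence[of 5 11 2]
    extremal_count_recurrence[of 5 11 3] extremal_count_recurrence[of 5 11 4]
    sum_extremal_count_split[of 5 11 "\<lambda>s. (- 1) ^ s * int (9 choose s)" 4]
  by (simp add: lessThan_nat_numeral binomial_fact' fact_numeral)

lemma small_word_support:
  assumes fin: "finite V" and n: "7 \<le> card V"
  obtains X where "X \<subseteq> V" "X \<noteq> {}" "2 * card (word_support V E X) \<le> card V"
proof (rule ccontr)
  assume "\<not> thesis"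
  then have large: "card V < 2 * card (word_support V E X)" if "X \<subseteq> V" "X \<noteq> {}" for X
    using that \<open>\<And>X. X \<subseteq> V \<Longrightarrow> X \<noteq> {} \<Longrightarrow> 2 * card (word_support V E X) \<le> card V \<Longrightarrow> thesis\<close>
    by (meson not_le)
  have nonneg: "0 \<le> extremal_count (card V) t" if "t \<le> card V" for t
    using extremal_count_constraints(1)[OF fin large that] .
  have parity: "(\<Sum>s\<le>t. (- 1) ^ s * int (t choose s) * extremal_count (card V) s)
      \<in> {0, \<Sum>s\<le>t. int (t choose s) * extremal_count (card V) s}" if "t \<le> card V" for t
    using extremal_count_constraints(2)[OF fin large that] .
  have not_7: "card V \<noteq> 7" and not_9: "card V \<noteq> 9" and not_11: "card V \<noteq> 11"
    using parity[of 6] parity[of 7] parity[of 9] 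
    by (auto simp: extremal_parity_sum_7 extremal_parity_sum_9 extremal_parity_sum_11
        sum_extremal_count)
  show False
  proof (cases "even (card V)")
    case True
    then obtain m where m: "card V = 2 * m" by (elim evenE)
    show False
      using nonneg[of "m + 2"] extremal_count_even[of m] m n by simp
  next
    case False
    then obtain m where m: "card V = 2 * m + 1" by (elim oddE)
    \<comment> \<open>Nonnegativity of \<open>5 - m\<close> leaves only \<open>m = 3, 4, 5\<close>,
      the three excluded sizes.\<close>
    have "m \<le> 5"
      using nonneg[of "m + 2"] extremal_count_odd[of m] m n by simp
    then show False
      using m n not_7 not_9 not_11 by presburger
  qed
qed

section \<open>From words to circuits\<close>

text \<open>Translates signs back to GF(2) row sums; for infinite \<open>X\<close> both sides
  default to 1.\<close>

lemma pairing_singleton_eq_adj: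
  "pairing E X {u} = (if (\<Sum>v\<in>X. adj_matrix E u v) = 0 then 1 else - 1)"
proof (induction X rule: infinite_finite_induct)
  case (insert x X)
  have "pairing E (insert x X) {u} = edge_sign E x u * pairing E X {u}"
    using insert.hyps by (simp add: pairing_def)
  then show ?case
    using insert by (auto simp: edge_sign_def adj_matrix_def insert_commute)
qed (auto simp: pairing_def)

lemma finite_dependent_contains_circuit:
  assumes "finite D" "D \<subseteq> fst N" "D \<notin> snd N"
  obtains C where "C \<subseteq> D" "circuit N C"
proof -
  have "\<exists>C. C \<subseteq> D \<and> circuit N C"
    using assms
  proof (induction D rule: finite_psubset_induct)
    case (psubset D)
    show ?case
    proof (cases "\<forall>D'. D' \<subset> D \<longrightarrow> D' \<in> snd N")
      case True
      then show ?thesis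
        using psubset.prems by (auto simp: circuit_def)
    next
      case False
      then obtain D' where "D' \<subset> D" "D' \<notin> snd N" by blast
      then show ?thesis
        using psubset.IH[of D'] psubset.prems by blast
    qed
  qed
  then show thesis using that by blast
qed

text \<open>The columns chosen on the support sum to zero, so they contain a circuit.\<close>

lemma transverse_circuit_of_word:
  assumes fin: "finite V" and X: "X \<subseteq> V" "X \<noteq> {}"
  obtains C where "transverse_circuit V E C" "card C \<le> card (word_support V E X)"
proof -
  let ?N = "odd_nbrs V E X" and ?S = "word_support V E X"
  \<comment> \<open>The default \<open>Phi\<close> outside the support extends the choice to a full
    transversal.\<close>
  define el where "el v = (if v \<in> X then if v \<in> ?N then Psi v else Chi v else Phi v)" for v
  have el_triple: "el w \<in> vertex_triple v \<longleftrightarrow> w = v" for v w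
    by (auto simp: el_def vertex_triple_def)
  have SV: "?S \<subseteq> V"
    using X by (auto simp: word_support_def odd_nbrs_def)
  have finS: "finite ?S"
    using SV fin finite_subset by blast
  have inj: "inj_on el ?S"
    by (rule inj_onI) (metis el_triple)
  have trans: "transversal V (el ` V)"
  proof -
    have "el ` V \<inter> vertex_triple v = {el v}" if "v \<in> V" for v
      using that by (auto simp: el_triple)
    then show ?thesis
      using el_triple by (auto simp: transversal_def ias_ground_def)
  qed
  have ground: "el ` ?S \<subseteq> ias_ground V"
    using SV trans by (auto simp: transversal_def)
  have "(\<Sum>x\<in>el ` ?S. ias_matrix E u x) = 0" if u: "u \<in> V" for u
  proof -
    have "(\<Sum>x\<in>el ` ?S. ias_matrix E u x) = (\<Sum>v\<in>?S. ias_matrix E u (el v))"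
      by (simp add: sum.reindex[OF inj])
    \<comment> \<open>Each chosen column splits into an \<open>A(G)\<close> part, present on
      \<open>X\<close>, and an identity part, present on \<open>?N\<close>.\<close>
    also have "\<dots> = (\<Sum>v\<in>?S. (if v \<in> X then adj_matrix E u v else 0)
        + (if v \<in> ?N then id_matrix u v else 0))"
      by (rule sum.cong) (auto simp: el_def word_support_def)
    also have "\<dots> = (\<Sum>v\<in>?S. if v \<in> X then adj_matrix E u v else 0)
        + (\<Sum>v\<in>?S. if v \<in> ?N then id_matrix u v else 0)"
      by (rule sum.distrib)
    also have "(\<Sum>v\<in>?S. if v \<in> X then adj_matrix E u v else 0) = (\<Sum>v\<in>X. adj_matrix E u v)"
      using finS by (simp add: sum.inter_restrict[symmetric] word_support_def Int_absorb1)
    also have "(\<Sum>v\<in>?S. if v \<in> ?N then id_matrix u v else 0)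
        = (\<Sum>v\<in>?S. if v = u then of_bool (u \<in> ?N) else 0)"
      by (rule sum.cong) (auto simp: id_matrix_def)
    also have "\<dots> = of_bool (u \<in> ?N)"
      using finS by (auto simp: word_support_def)
    also have "(\<Sum>v\<in>X. adj_matrix E u v) = of_bool (u \<in> ?N)"
      using u by (simp add: odd_nbrs_def pairing_singleton_eq_adj)
    \<comment> \<open>Both parts equal the indicator of \<open>?N\<close> and cancel in
      characteristic 2.\<close>
    finally show ?thesis by simp
  qed
  moreover have "?S \<noteq> {}"
    using X by (auto simp: word_support_def)
  ultimately have "\<exists>c. (\<forall>u\<in>V. (\<Sum>x\<in>el ` ?S. c x * ias_matrix E u x) = 0) \<and> (\<exists>x\<in>el ` ?S. c x \<noteq> 0)"
    by (intro exI[of _ "\<lambda>_. 1"]) (auto simp del: mult_bit_eq_and)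
  then have "el ` ?S \<notin> snd (ias_matroid V E)"
    unfolding ias_matroid_def represented_matroid_def by auto
  then obtain C where C: "C \<subseteq> el ` ?S" "circuit (ias_matroid V E) C"
    using finite_dependent_contains_circuit[of "el ` ?S" "ias_matroid V E"] finS ground
    by (auto simp: ias_matroid_def represented_matroid_def)
  show thesis
  proof
    show "transverse_circuit V E C"
      using C trans image_mono[OF SV, of el] unfolding transverse_circuit_def by blast
    show "card C \<le> card ?S"
      using C(1) finS by (meson card_image_le card_mono finite_imageI le_trans)
  qed
qed

theorem theorem38:
  fixes V :: "'v set" and E :: "'v set set"
  assumes "looped_simple_graph V E"
    and "card V \<ge> 7"
  shows "\<exists>C. transverse_circuit V E C \<and> real (card C) \<le> real (card V) / 2"
proof -
  have fin: "finite V"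
    using assms(1) by (simp add: looped_simple_graph_def)
  obtain X where X: "X \<subseteq> V" "X \<noteq> {}" "2 * card (word_support V E X) \<le> card V"
    using small_word_support[OF fin assms(2)] .
  obtain C where C: "transverse_circuit V E C" "card C \<le> card (word_support V E X)"
    using transverse_circuit_of_word[OF fin X(1,2)] .
  from C(2) X(3) have "real (card C) \<le> real (card V) / 2"
    by linarith
  with C(1) show ?thesis by blast
qed

end
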